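(* Let $G$ be a finite, simple, connected (non-empty) graph. The bold homology group $\mathbb{H}_1(G)$, with coefficients in a field, is non-zero if and only if $G$ is a complete graph.
   Context: Bold homology. Let $G$ be a finite simple graph and $\mathbb{K}$ a field; order $V(G)$. A bi-colouring is a map $\varepsilon\colon V(G)\to\{0,1\}$, and $G_\varepsilon$ denotes the subgraph of $G$ induced by the vertices $v$ with $\varepsilon(v)=1$. Write $\varepsilon\,\widetilde{\triangleleft}\,\varepsilon'$ if $\varepsilon'$ is obtained from $\varepsilon$ by changing the value at exactly one vertex from $0$ to $1$. A sign assignment is a choice of $s(\varepsilon,\varepsilon')\in\mathbb{Z}/2$ for each such pair with $s(\varepsilon,\varepsilon_1)+s(\varepsilon_1,\varepsilon'')\equiv s(\varepsilon,\varepsilon_2)+s(\varepsilon_2,\varepsilon'')+1\pmod 2$ whenever $\varepsilon\,\widetilde{\triangleleft}\,\varepsilon_1,\varepsilon_2\,\widetilde{\triangleleft}\,\varepsilon''$, $\varepsilon_1\neq\varepsilon_2$; it exists and the choice does not affect the complex up to isomorphism. The bold chain group is \[\mathrm{C}\mathbb{H}_i(G)=\bigoplus_{\varepsilon:\ \sum_v\varepsilon(v)=i}\ \bigoplus_{x\in\pi_0(G_\varepsilon)}\mathbb{K}\langle x\rangle,\] where $\pi_0$ is the set of connected components (so $\mathrm{C}\mathbb{H}_0=0$), with differential $d^i\colon \mathrm{C}\mathbb{H}_i\to\mathrm{C}\mathbb{H}_{i+1}$ given for $x\in\pi_0(G_\varepsilon)$ by $d^i(x)=\sum(-1)^{s(\varepsilon,\varepsilon')}y$,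 the sum over all $\varepsilon'$ with $\varepsilon\,\widetilde{\triangleleft}\,\varepsilon'$ and the component $y\in\pi_0(G_{\varepsilon'})$ with $V(x)\subseteq V(y)$. Its homology is the bold homology $\mathbb{H}_*(G)$. *)

theory Defs
  imports
    "HOL-Algebra.Coset"
    "HOL-Library.FuncSet"
    "HOL-Library.Z2"
    "Graph_Theory.Digraph_Component"
    "Graph_Theory.Kuratowski"
begin

text \<open>
  Finite simple graphs are the symmetric, loop-free digraphs without parallel arcs of the
  locale \<^locale>\<open>graph\<close>: each edge is a pair of opposite arcs.
\<close>

definition bicolourings :: "('a, 'b) pre_digraph \<Rightarrow> ('a \<Rightarrow> nat) set" where
  "bicolourings G = verts G \<rightarrow>\<^sub>E {0, 1}"

definition coloured_subgraph :: "('a, 'b) pre_digraph \<Rightarrow> ('a \<Rightarrow> nat) \<Rightarrow> ('a, 'b) pre_digraph" where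
  "coloured_subgraph G \<epsilon> = G \<restriction> {v \<in> verts G. \<epsilon> v = 1}"

definition colour_step :: "('a, 'b) pre_digraph \<Rightarrow> ('a \<Rightarrow> nat) \<Rightarrow> ('a \<Rightarrow> nat) \<Rightarrow> bool" where
  "colour_step G \<epsilon> \<epsilon>' \<longleftrightarrow>
     \<epsilon> \<in> bicolourings G \<and> \<epsilon>' \<in> bicolourings G \<and> (\<exists>v \<in> verts G. \<epsilon> v = 0 \<and> \<epsilon>' = \<epsilon>(v := 1))"

text \<open>The type \<^typ>\<open>bit\<close> is the field \<open>\<int>/2\<close>; values of \<open>s\<close> off the steps are irrelevant.\<close>

definition sign_assignment ::
  "('a, 'b) pre_digraph \<Rightarrow> (('a \<Rightarrow> nat) \<Rightarrow> ('a \<Rightarrow> nat) \<Rightarrow> bit) \<Rightarrow> bool" where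
  "sign_assignment G s \<longleftrightarrow>
     (\<forall>\<epsilon> \<epsilon>\<^sub>1 \<epsilon>\<^sub>2 \<epsilon>''. colour_step G \<epsilon> \<epsilon>\<^sub>1 \<and> colour_step G \<epsilon>\<^sub>1 \<epsilon>'' \<and>
        colour_step G \<epsilon> \<epsilon>\<^sub>2 \<and> colour_step G \<epsilon>\<^sub>2 \<epsilon>'' \<and> \<epsilon>\<^sub>1 \<noteq> \<epsilon>\<^sub>2 \<longrightarrow>
        s \<epsilon> \<epsilon>\<^sub>1 + s \<epsilon>\<^sub>1 \<epsilon>'' = s \<epsilon> \<epsilon>\<^sub>2 + s \<epsilon>\<^sub>2 \<epsilon>'' + 1)"

text \<open>
  The usual sign assignment: fix an enumeration of the vertices and, for a step at \<open>v\<close>, count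
  modulo 2 the vertices of colour 1 that precede \<open>v\<close>.
\<close>

lemma sign_assignment_exists:
  assumes "finite (verts G)"
  shows "\<exists>s. sign_assignment G s"
proof -
  obtain f :: "'a \<Rightarrow> nat" where f: "inj_on f (verts G)"
    using assms finite_imp_inj_to_nat_seg by metis
  define N where "N = (\<lambda>\<epsilon> v. card {w \<in> verts G. \<epsilon> w = (1::nat) \<and> f w < f v})"
  define s :: "('a \<Rightarrow> nat) \<Rightarrow> ('a \<Rightarrow> nat) \<Rightarrow> bit" where
    "s = (\<lambda>\<epsilon> \<epsilon>'. of_nat (N \<epsilon> (THE v. \<epsilon> v \<noteq> \<epsilon>' v)))"
  have s_eq: "s \<epsilon> (\<epsilon>(v := 1)) = of_nat (N \<epsilon> v)" if "\<epsilon> v = 0" for \<epsilon> v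
  proof -
    have "(THE u. \<epsilon> u \<noteq> (\<epsilon>(v := 1)) u) = v"
      using that by (intro the_equality) (auto split: if_splits)
    then show ?thesis by (simp add: s_def)
  qed
  have N_upd: "N (\<epsilon>(u := 1)) v = N \<epsilon> v + (if f u < f v then 1 else 0)"
    if "u \<in> verts G" "\<epsilon> u = 0" for \<epsilon> u v
  proof -
    have "{w \<in> verts G. (\<epsilon>(u := 1)) w = 1 \<and> f w < f v} =
      (if f u < f v then insert u {w \<in> verts G. \<epsilon> w = 1 \<and> f w < f v}
       else {w \<in> verts G. \<epsilon> w = 1 \<and> f w < f v})"
      using that by auto
    then show ?thesis using that assms by (simp add: N_def)
  qed
  have "s \<epsilon> \<epsilon>\<^sub>1 + s \<epsilon>\<^sub>1 \<epsilon>'' = s \<epsilon> \<epsilon>\<^sub>2 + s \<epsilon>\<^sub>2 \<epsilon>'' + 1"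
    if st: "colour_step G \<epsilon> \<epsilon>\<^sub>1" "colour_step G \<epsilon>\<^sub>1 \<epsilon>''"
      "colour_step G \<epsilon> \<epsilon>\<^sub>2" "colour_step G \<epsilon>\<^sub>2 \<epsilon>''" "\<epsilon>\<^sub>1 \<noteq> \<epsilon>\<^sub>2" for \<epsilon> \<epsilon>\<^sub>1 \<epsilon>\<^sub>2 \<epsilon>''
  proof -
    obtain u where u: "u \<in> verts G" "\<epsilon> u = 0" "\<epsilon>\<^sub>1 = \<epsilon>(u := 1)"
      using st(1) by (auto simp: colour_step_def)
    obtain v where v: "v \<in> verts G" "\<epsilon> v = 0" "\<epsilon>\<^sub>2 = \<epsilon>(v := 1)"
      using st(3) by (auto simp: colour_step_def)
    have uv: "u \<noteq> v" using st(5) u v by auto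
    obtain a where a: "\<epsilon>\<^sub>1 a = 0" "\<epsilon>'' = \<epsilon>\<^sub>1(a := 1)"
      using st(2) by (auto simp: colour_step_def)
    obtain b where b: "\<epsilon>\<^sub>2 b = 0" "\<epsilon>'' = \<epsilon>\<^sub>2(b := 1)"
      using st(4) by (auto simp: colour_step_def)
    have "\<epsilon>'' v = 1" by (simp add: b(2) v(3))
    moreover have "\<epsilon>'' v = 0" if "a \<noteq> v" using that uv u(3) v(2) by (simp add: a(2))
    ultimately have "a = v" by fastforce
    have "\<epsilon>'' u = 1" by (simp add: a(2) u(3))
    moreover have "\<epsilon>'' u = 0" if "b \<noteq> u" using that uv v(3) u(2) by (simp add: b(2))
    ultimately have "b = u" by fastforce
    from \<open>a = v\<close> \<open>b = u\<close> have e: "\<epsilon>'' = \<epsilon>\<^sub>1(v := 1)" "\<epsilon>\<^sub>1 v = 0" "\<epsilon>'' = \<epsilon>\<^sub>2(u := 1)" "\<epsilon>\<^sub>2 u = 0"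
      using a b by auto
    have s: "s \<epsilon> \<epsilon>\<^sub>1 = of_nat (N \<epsilon> u)" "s \<epsilon> \<epsilon>\<^sub>2 = of_nat (N \<epsilon> v)"
      "s \<epsilon>\<^sub>1 \<epsilon>'' = of_nat (N \<epsilon>\<^sub>1 v)" "s \<epsilon>\<^sub>2 \<epsilon>'' = of_nat (N \<epsilon>\<^sub>2 u)"
      using s_eq[of \<epsilon> u] s_eq[of \<epsilon> v] s_eq[of \<epsilon>\<^sub>1 v] s_eq[of \<epsilon>\<^sub>2 u] u v e by auto
    have n: "N \<epsilon>\<^sub>1 v = N \<epsilon> v + (if f u < f v then 1 else 0)"
      "N \<epsilon>\<^sub>2 u = N \<epsilon> u + (if f v < f u then 1 else 0)"
      using N_upd u v by auto
    have "f u \<noteq> f v" using f uv u v by (auto dest: inj_onD)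
    then consider "f u < f v" | "f v < f u" by linarith
    then show ?thesis
    proof cases
      case 1
      then show ?thesis by (simp add: s n)
    next
      case 2
      then show ?thesis
        by (cases "of_nat (N \<epsilon> u) :: bit"; cases "of_nat (N \<epsilon> v) :: bit") (simp_all add: s n)
    qed
  qed
  then have "sign_assignment G s"
    unfolding sign_assignment_def by blast
  then show ?thesis by blast
qed

definition components :: "('a, 'b) pre_digraph \<Rightarrow> ('a, 'b) pre_digraph set" where
  "components H = {x. pre_digraph.max_subgraph H Digraph_Component.connected x}"

type_synonym ('a, 'b) bold_generator = "('a \<Rightarrow> nat) \<times> ('a, 'b) pre_digraph"

definition bold_generators :: "('a, 'b) pre_digraph \<Rightarrow> nat \<Rightarrow> ('a, 'b) bold_generator set" where
  "bold_generators G i =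
     {(\<epsilon>, x). \<epsilon> \<in> bicolourings G \<and> (\<Sum>v\<in>verts G. \<epsilon> v) = i \<and> x \<in> components (coloured_subgraph G \<epsilon>)}"

text \<open>
  For finite \<open>G\<close> there are finitely many generators, so the direct sum consists of all
  coefficient functions supported on them.  Homology is formed as a quotient of the
  underlying additive groups.
\<close>

definition bold_chain_group ::
  "('a, 'b) pre_digraph \<Rightarrow> nat \<Rightarrow> (('a, 'b) bold_generator \<Rightarrow> 'k::field) monoid" where
  "bold_chain_group G i =
     \<lparr>carrier = {c. \<forall>b. b \<notin> bold_generators G i \<longrightarrow> c b = 0},
      monoid.mult = (\<lambda>c c' b. c b + c' b),
      one = (\<lambda>b. 0)\<rparr>"

text \<open>The coefficient of the generator \<open>(\<epsilon>', y)\<close> in the differential of \<open>(\<epsilon>, x)\<close>.\<close>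

definition bold_incidence ::
  "('a, 'b) pre_digraph \<Rightarrow> (('a \<Rightarrow> nat) \<Rightarrow> ('a \<Rightarrow> nat) \<Rightarrow> bit) \<Rightarrow>
   ('a, 'b) bold_generator \<Rightarrow> ('a, 'b) bold_generator \<Rightarrow> 'k::field" where
  "bold_incidence G s = (\<lambda>(\<epsilon>, x) (\<epsilon>', y).
     if colour_step G \<epsilon> \<epsilon>' \<and> y \<in> components (coloured_subgraph G \<epsilon>') \<and> verts x \<subseteq> verts y
     then (if s \<epsilon> \<epsilon>' = 0 then 1 else - 1) else 0)"

definition bold_differential ::
  "('a, 'b) pre_digraph \<Rightarrow> (('a \<Rightarrow> nat) \<Rightarrow> ('a \<Rightarrow> nat) \<Rightarrow> bit) \<Rightarrow> nat \<Rightarrow>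
   (('a, 'b) bold_generator \<Rightarrow> 'k::field) \<Rightarrow> ('a, 'b) bold_generator \<Rightarrow> 'k" where
  "bold_differential G s i c = (\<lambda>b'. \<Sum>b\<in>bold_generators G i. c b * bold_incidence G s b b')"

definition bold_cycles ::
  "('a, 'b) pre_digraph \<Rightarrow> (('a \<Rightarrow> nat) \<Rightarrow> ('a \<Rightarrow> nat) \<Rightarrow> bit) \<Rightarrow> nat \<Rightarrow>
   (('a, 'b) bold_generator \<Rightarrow> 'k::field) set" where
  "bold_cycles G s i =
     kernel (bold_chain_group G i) (bold_chain_group G (i + 1)) (bold_differential G s i)"

definition bold_boundaries ::
  "('a, 'b) pre_digraph \<Rightarrow> (('a \<Rightarrow> nat) \<Rightarrow> ('a \<Rightarrow> nat) \<Rightarrow> bit) \<Rightarrow> nat \<Rightarrow>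
   (('a, 'b) bold_generator \<Rightarrow> 'k::field) set" where
  "bold_boundaries G s i =
     (case i of 0 \<Rightarrow> {\<one>\<^bsub>bold_chain_group G 0\<^esub>}
      | Suc j \<Rightarrow> bold_differential G s j ` carrier (bold_chain_group G j))"

definition bold_homology ::
  "('a, 'b) pre_digraph \<Rightarrow> (('a \<Rightarrow> nat) \<Rightarrow> ('a \<Rightarrow> nat) \<Rightarrow> bit) \<Rightarrow> nat \<Rightarrow>
   (('a, 'b) bold_generator \<Rightarrow> 'k::field) set monoid" where
  "bold_homology G s i =
     (bold_chain_group G i)\<lparr>carrier := bold_cycles G s i\<rparr> Mod bold_boundaries G s i"

end

theory Submission
  imports Defs
begin

text \<open>
  The empty graph has no component, so the chain group in degree 0 vanishes and \<open>H\<^sub>1\<close> is the space of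
  1-cycles. A 1-chain is a scalar \<open>c\<^sub>v\<close> for each vertex \<open>v\<close>, because the colourings with one
  vertex \<open>v\<close> of colour 1 give one-vertex graphs, each with a single component.

  Its differential is read off one pair \<open>u \<noteq> w\<close> at a time. Let \<open>y\<^sub>v = \<plusminus>c\<^sub>v\<close>, where the sign is
  that of the step \<open>{} \<rightarrow> {v}\<close>.

  \<^item> If \<open>u\<close> and \<open>w\<close> are adjacent, there is one component. By the sign condition for the square
    \<open>{}\<close>, \<open>{u}\<close>, \<open>{w}\<close>, \<open>{u, w}\<close> it receives \<open>\<plusminus>(y\<^sub>u - y\<^sub>w)\<close> (lemma \<open>bold_differential_edge\<close>); a cycle therefore has \<open>y\<^sub>u = y\<^sub>w\<close>.
  \<^item> Otherwise the components are \<open>u\<close> and \<open>w\<close>, which receive \<open>\<plusminus>c\<^sub>u\<close> and \<open>\<plusminus>c\<^sub>w\<close>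
    (lemma \<open>bold_differential_nonedge\<close>); a cycle therefore has \<open>c\<^sub>u = c\<^sub>w = 0\<close>.

  On a complete graph only the first kind of equation occurs, and \<open>y = 1\<close> is a nonzero cycle. On
  a connected graph the equations of the first kind make \<open>y\<close> constant, and a single non-adjacent
  pair makes this constant 0.
\<close>

section \<open>Components of cliques and of arcless graphs\<close>

lemma connected_clique:
  assumes "verts H \<noteq> {}"
    and "\<And>u v. u \<in> verts H \<Longrightarrow> v \<in> verts H \<Longrightarrow> u \<noteq> v \<Longrightarrow> u \<rightarrow>\<^bsub>H\<^esub> v"
  shows "Digraph_Component.connected H"
  unfolding connected_conv
proof (intro conjI ballI)
  fix u v assume "u \<in> verts H" "v \<in> verts H"
  then show "(u, v) \<in> rtrancl_on (verts H) ((arcs_ends H)\<^sup>s)"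
    using assms(2)[of u v] rtrancl_on_into_rtrancl_on[OF rtrancl_on_refl, of u "verts H" v]
    by (cases "u = v") (simp_all add: symcl_def)
qed (fact assms(1))

text \<open>
  Among subgraphs of \<open>H\<close> the largest is \<open>H\<close> itself, so once it is connected nothing else is
  maximal.
\<close>

lemma components_connected:
  assumes "wf_digraph H" and "Digraph_Component.connected H"
  shows "components H = {H}"
proof -
  have refl: "subgraph H H"
    using assms(1) by (rule wf_digraph.subgraph_refl)
  have antisym: "x = H" if "subgraph H x" "subgraph x H" for x
    using that by (intro pre_digraph.equality) (auto simp: subgraph_def compatible_def)
  have "pre_digraph.max_subgraph H Digraph_Component.connected x \<longleftrightarrow> x = H" for x
    unfolding pre_digraph.max_subgraph_def using refl antisym assms(2) by metis
  then show ?thesis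
    by (auto simp: components_def)
qed

lemma components_nonempty:
  "x \<in> components H \<Longrightarrow> verts x \<noteq> {}"
  by (auto simp: components_def pre_digraph.max_subgraph_def connected_conv)

lemma components_subset:
  "x \<in> components H \<Longrightarrow> verts x \<subseteq> verts H"
  by (auto simp: components_def pre_digraph.max_subgraph_def subgraph_def)

lemma connected_arcless:
  assumes "Digraph_Component.connected H" and "arcs H = {}" and "u \<in> verts H" and "v \<in> verts H"
  shows "u = v"
proof -
  have "(u, v) \<in> rtrancl_on (verts H) {}"
    using assms by (auto simp: connected_conv symcl_def arcs_ends_def)
  then show ?thesis
    by (induction rule: rtrancl_on.induct) auto
qed

text \<open>
  The components of two non-adjacent vertices: anything larger than a single vertex is
  disconnected for want of arcs.
\<close>

lemma singleton_component_arcless: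
  assumes "wf_digraph H" and "arcs H = {}" and "v \<in> verts H"
  shows "H \<restriction> {v} \<in> components H"
proof -
  interpret wf_digraph H by fact
  have "subgraph (H \<restriction> {v}) H"
    using assms by (auto simp: subgraph_def compatible_def)
  moreover have "Digraph_Component.connected (H \<restriction> {v})"
    by (rule connected_clique) auto
  moreover have "x = H \<restriction> {v}"
    if x: "subgraph (H \<restriction> {v}) x" "subgraph x H" "Digraph_Component.connected x" for x
  proof -
    have a: "arcs x = {}" and v: "v \<in> verts x"
      using x assms(2) by (auto simp: subgraph_def)
    then have "verts x = {v}"
      using connected_arcless[OF x(3) a] by blast
    with a show ?thesis
      using x(2) assms(2) by (intro pre_digraph.equality) (auto simp: subgraph_def compatible_def)
  qed
  ultimately show ?thesis
    by (auto simp: components_def pre_digraph.max_subgraph_def)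
qed

section \<open>Bi-colourings as sets of vertices\<close>

text \<open>
  Indicator functions identify the bi-colourings with the sets of vertices of colour 1, and steps
  with the insertion of one new vertex. Outside \<open>verts G\<close> the value is \<open>undefined\<close>, as membership
  in \<open>bicolourings G\<close> demands.
\<close>

definition colouring :: "('a, 'b) pre_digraph \<Rightarrow> 'a set \<Rightarrow> 'a \<Rightarrow> nat" where
  "colouring G S = (\<lambda>v\<in>verts G. if v \<in> S then 1 else 0)"

lemma bicolourings_eq: "bicolourings G = colouring G ` Pow (verts G)"
proof (intro equalityI subsetI)
  fix \<epsilon> assume \<epsilon>: "\<epsilon> \<in> bicolourings G"
  have "\<epsilon> = colouring G {v \<in> verts G. \<epsilon> v = 1}"
  proof
    fix v
    have "v \<in> verts G \<Longrightarrow> \<epsilon> v = 0 \<or> \<epsilon> v = 1" "v \<notin> verts G \<Longrightarrow> \<epsilon> v = undefined"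
      using \<epsilon> PiE_mem[of \<epsilon> "verts G" "\<lambda>_. {0, 1}" v] PiE_arb[of \<epsilon> "verts G" _ v]
      unfolding bicolourings_def by blast+
    then show "\<epsilon> v = colouring G {v \<in> verts G. \<epsilon> v = 1} v"
      by (cases "v \<in> verts G") (auto simp: colouring_def)
  qed
  then show "\<epsilon> \<in> colouring G ` Pow (verts G)"
    by (rule image_eqI) auto
next
  fix \<epsilon> assume "\<epsilon> \<in> colouring G ` Pow (verts G)"
  then obtain S where "\<epsilon> = colouring G S"
    by blast
  then show "\<epsilon> \<in> bicolourings G"
    by (simp add: colouring_def bicolourings_def PiE_iff)
qed

lemma colouring_inject:
  assumes "S \<subseteq> verts G" and "T \<subseteq> verts G"
  shows "colouring G S = colouring G T \<longleftrightarrow> S = T"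
proof
  have *: "R = {v \<in> verts G. colouring G R v = 1}" if "R \<subseteq> verts G" for R
    using that by (auto simp: colouring_def)
  assume "colouring G S = colouring G T"
  then show "S = T"
    using *[OF assms(1)] *[OF assms(2)] by metis
qed simp

lemma coloured_subgraph_colouring:
  "S \<subseteq> verts G \<Longrightarrow> coloured_subgraph G (colouring G S) = G \<restriction> S"
  unfolding coloured_subgraph_def colouring_def
  by (rule arg_cong[where f = "\<lambda>S. G \<restriction> S"]) auto

lemma sum_colouring:
  assumes "finite (verts G)" and "S \<subseteq> verts G"
  shows "(\<Sum>v\<in>verts G. colouring G S v) = card S"
proof -
  have "(\<Sum>v\<in>verts G. colouring G S v) = (\<Sum>v\<in>verts G. if v \<in> S then 1 else 0)"
    by (intro sum.cong) (auto simp: colouring_def)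
  also have "\<dots> = card S"
    using assms by (simp add: sum.If_cases Int_absorb1)
  finally show ?thesis .
qed

lemma colouring_update:
  "v \<in> verts G \<Longrightarrow> (colouring G S)(v := 1) = colouring G (insert v S)"
  by (auto simp: colouring_def fun_eq_iff)

lemma colour_step_colouring:
  assumes "S \<subseteq> verts G"
  shows "colour_step G (colouring G S) \<epsilon>' \<longleftrightarrow> (\<exists>v\<in>verts G - S. \<epsilon>' = colouring G (insert v S))"
proof -
  have "colouring G S \<in> bicolourings G"
    using assms by (auto simp: bicolourings_eq)
  moreover have "colouring G (insert v S) \<in> bicolourings G" if "v \<in> verts G" for v
    using assms that by (auto simp: bicolourings_eq)
  moreover have "colouring G S v = 0 \<longleftrightarrow> v \<notin> S" if "v \<in> verts G" for v
    using that by (auto simp: colouring_def)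
  ultimately show ?thesis
    using colouring_update[of _ G S] unfolding colour_step_def by (metis DiffD1 DiffD2 DiffI)
qed

section \<open>The groups in degrees zero and one\<close>

lemma bold_generators_eq:
  assumes "finite (verts G)"
  shows "bold_generators G i =
    {(colouring G S, x) | S x. S \<subseteq> verts G \<and> card S = i \<and> x \<in> components (G \<restriction> S)}"
proof -
  have "bold_generators G i = {(\<epsilon>, x). \<exists>S \<subseteq> verts G. \<epsilon> = colouring G S \<and>
      (\<Sum>v\<in>verts G. \<epsilon> v) = i \<and> x \<in> components (coloured_subgraph G \<epsilon>)}"
    unfolding bold_generators_def bicolourings_eq by blast
  also have "\<dots> = {(\<epsilon>, x). \<exists>S \<subseteq> verts G. \<epsilon> = colouring G S \<and>
      card S = i \<and> x \<in> components (G \<restriction> S)}"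
    using sum_colouring[OF assms] coloured_subgraph_colouring[of _ G] by (metis (lifting))
  also have "\<dots> = {(colouring G S, x) | S x. S \<subseteq> verts G \<and> card S = i \<and> x \<in> components (G \<restriction> S)}"
    by blast
  finally show ?thesis .
qed

lemma bold_generators_0:
  assumes "finite (verts G)"
  shows "bold_generators G 0 = {}"
proof -
  have "components (G \<restriction> {}) = {}"
    using components_nonempty components_subset by fastforce
  moreover have "S = {}" if "S \<subseteq> verts G" "card S = 0" for S
    using that assms finite_subset[of S] by auto
  ultimately show ?thesis
    using assms by (auto simp: bold_generators_eq)
qed

definition vertex_generator :: "('a, 'b) pre_digraph \<Rightarrow> 'a \<Rightarrow> ('a, 'b) bold_generator" where
  "vertex_generator G v = (colouring G {v}, G \<restriction> {v})"

lemma inj_on_vertex_generator: "inj_on (vertex_generator G) (verts G)"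
  by (auto simp: inj_on_def vertex_generator_def colouring_inject)

lemma components_clique:
  assumes "wf_digraph G" and "S \<subseteq> verts G" and "S \<noteq> {}"
    and "\<And>u v. u \<in> S \<Longrightarrow> v \<in> S \<Longrightarrow> u \<noteq> v \<Longrightarrow> u \<rightarrow>\<^bsub>G\<^esub> v"
  shows "components (G \<restriction> S) = {G \<restriction> S}"
proof (rule components_connected)
  show "wf_digraph (G \<restriction> S)"
    using assms(1) by (rule wf_digraph.wellformed_induce_subgraph)
  show "Digraph_Component.connected (G \<restriction> S)"
  proof (rule connected_clique)
    fix u v assume "u \<in> verts (G \<restriction> S)" "v \<in> verts (G \<restriction> S)" "u \<noteq> v"
    then show "u \<rightarrow>\<^bsub>G \<restriction> S\<^esub> v"
      using assms(4)[of u v] by (auto simp: arcs_ends_conv image_iff)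
  qed (use assms(3) in simp)
qed

lemma bold_generators_1:
  assumes "Digraph.graph G"
  shows "bold_generators G 1 = vertex_generator G ` verts G"
proof -
  interpret Digraph.graph G by fact
  have "components (G \<restriction> {v}) = {G \<restriction> {v}}" if "v \<in> verts G" for v
    using that wf_digraph by (intro components_clique) auto
  then show ?thesis
    by (auto simp: bold_generators_eq vertex_generator_def card_1_singleton_iff)
qed

lemma bold_boundaries_1:
  fixes G :: "('a, 'b) pre_digraph"
  assumes "finite (verts G)"
  shows "bold_boundaries G s 1 = {\<lambda>_. 0 :: 'k::field}"
proof -
  let ?C = "carrier (bold_chain_group G 0) :: (('a, 'b) bold_generator \<Rightarrow> 'k) set"
  have zero: "(\<lambda>_. 0) \<in> ?C"
    by (simp add: bold_chain_group_def)
  have "bold_boundaries G s 1 = (\<lambda>_ _. 0 :: 'k) ` ?C"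
    by (simp add: bold_boundaries_def bold_differential_def[abs_def] bold_generators_0[OF assms])
  also have "\<dots> = {\<lambda>_. 0}"
    using zero by (rule image_constant)
  finally show ?thesis .
qed

lemma bold_cycles_iff:
  "c \<in> bold_cycles G s i \<longleftrightarrow>
    (\<forall>b. b \<notin> bold_generators G i \<longrightarrow> c b = 0) \<and> (\<forall>b. bold_differential G s i c b = 0)"
  unfolding bold_cycles_def kernel_def bold_chain_group_def by (simp add: fun_eq_iff)

text \<open>
  The boundaries are trivial, so the cosets that make up \<open>H\<^sub>1\<close> are the singletons of the cycles.
\<close>

lemma bold_homology_1_nontrivial_iff:
  fixes H1 :: "(('a, 'b) bold_generator \<Rightarrow> 'k::field) set monoid"
  assumes "finite (verts G)" and "H1 = bold_homology G s 1"
  shows "carrier H1 \<noteq> {\<one>\<^bsub>H1\<^esub>} \<longleftrightarrow> (\<exists>c\<in>bold_cycles G s 1. c \<noteq> (\<lambda>_. 0 :: 'k))"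
proof -
  have rcos: "{\<lambda>_. 0} #>\<^bsub>(bold_chain_group G 1)\<lparr>carrier := Z\<rparr>\<^esub> c = {c}"
    for Z and c :: "('a, 'b) bold_generator \<Rightarrow> 'k"
    by (simp add: r_coset_def bold_chain_group_def)
  have "carrier H1 = (\<lambda>c. {c}) ` bold_cycles G s 1" and "\<one>\<^bsub>H1\<^esub> = {\<lambda>_. 0}"
    unfolding assms(2) bold_homology_def FactGroup_def RCOSETS_def bold_boundaries_1[OF assms(1)] rcos
    by auto
  moreover have "(\<lambda>_. 0 :: 'k) \<in> bold_cycles G s 1"
    by (simp add: bold_cycles_iff bold_differential_def)
  moreover have "(\<lambda>c. {c}) ` Z \<noteq> {{z}} \<longleftrightarrow> (\<exists>c\<in>Z. c \<noteq> z)" if "z \<in> Z"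
    for z and Z :: "(('a, 'b) bold_generator \<Rightarrow> 'k) set"
    using that by auto
  ultimately show ?thesis
    by simp
qed

section \<open>The differential out of degree one\<close>

definition step_sign ::
  "('a, 'b) pre_digraph \<Rightarrow> (('a \<Rightarrow> nat) \<Rightarrow> ('a \<Rightarrow> nat) \<Rightarrow> bit) \<Rightarrow> 'a set \<Rightarrow> 'a set \<Rightarrow> 'k::field" where
  "step_sign G s S T = (if s (colouring G S) (colouring G T) = 0 then 1 else - 1)"

lemma step_sign_nonzero: "step_sign G s S T \<noteq> 0"
  by (simp add: step_sign_def)

text \<open>
  The sign condition is applied to the square that starts at \<open>{}\<close>, although no generator lives
  there: it compares the signs with which two different vertices reach \<open>{u, w}\<close>.
\<close>

lemma step_sign_square:
  assumes "sign_assignment G s" and "u \<in> verts G" and "w \<in> verts G" and "u \<noteq> w"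
  shows "step_sign G s {} {u} * step_sign G s {u} {u, w} =
    - (step_sign G s {} {w} * step_sign G s {w} {u, w} :: 'k::field)"
proof -
  let ?c = "colouring G"
  have "colour_step G (?c {}) (?c {u})" "colour_step G (?c {u}) (?c {u, w})"
    "colour_step G (?c {}) (?c {w})" "colour_step G (?c {w}) (?c {u, w})" "?c {u} \<noteq> ?c {w}"
    using assms(2-4) by (auto simp: colour_step_colouring colouring_inject insert_commute)
  then have "s (?c {}) (?c {u}) + s (?c {u}) (?c {u, w}) =
      s (?c {}) (?c {w}) + s (?c {w}) (?c {u, w}) + 1"
    using assms(1) unfolding sign_assignment_def by blast
  then show ?thesis
    unfolding step_sign_def
    by (cases "s (?c {}) (?c {u})"; cases "s (?c {u}) (?c {u, w})";
        cases "s (?c {}) (?c {w})"; cases "s (?c {w}) (?c {u, w})") simp_all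
qed

lemma bold_incidence_vertex:
  assumes "v \<in> verts G"
  shows "bold_incidence G s (vertex_generator G v) (\<epsilon>', y) =
    (if (\<exists>w\<in>verts G - {v}. \<epsilon>' = colouring G {w, v}) \<and>
        y \<in> components (coloured_subgraph G \<epsilon>') \<and> v \<in> verts y
     then (if s (colouring G {v}) \<epsilon>' = 0 then 1 else - 1) else 0 :: 'k::field)"
  using assms by (simp add: bold_incidence_def vertex_generator_def colour_step_colouring)

text \<open>
  A vertex generator can reach \<open>{u, w}\<close> only from \<open>u\<close> or from \<open>w\<close>, and it reaches the component
  \<open>y\<close> exactly when its vertex lies in \<open>y\<close>.
\<close>

lemma bold_differential_pair:
  fixes c :: "('a, 'b) bold_generator \<Rightarrow> 'k::field"
  assumes "Digraph.graph G" and "u \<in> verts G" and "w \<in> verts G" and "u \<noteq> w"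
    and y: "y \<in> components (G \<restriction> {u, w})"
  shows "bold_differential G s 1 c (colouring G {u, w}, y) =
    (\<Sum>v\<in>verts y. c (vertex_generator G v) * step_sign G s {v} {u, w})"
proof -
  interpret Digraph.graph G by fact
  have y_sub: "verts y \<subseteq> {u, w}"
    using components_subset[OF y] by simp
  have inc: "bold_incidence G s (vertex_generator G v) (colouring G {u, w}, y) =
      (if v \<in> verts y then step_sign G s {v} {u, w} else 0 :: 'k)" if "v \<in> verts G" for v
  proof -
    have "\<exists>x\<in>verts G - {v}. {u, w} = {x, v}" if "v \<in> verts y"
      using that y_sub assms(2-4) by blast
    then have "v \<in> verts y \<Longrightarrow> \<exists>x\<in>verts G - {v}. colouring G {u, w} = colouring G {x, v}"
      by metis
    then show ?thesis
      using that y assms(2,3)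
      by (auto simp: bold_incidence_vertex coloured_subgraph_colouring step_sign_def)
  qed
  have "bold_differential G s 1 c (colouring G {u, w}, y) =
      (\<Sum>v\<in>verts G. c (vertex_generator G v) *
        bold_incidence G s (vertex_generator G v) (colouring G {u, w}, y))"
    using inj_on_vertex_generator[of G]
    by (simp add: bold_differential_def bold_generators_1[OF assms(1), simplified] sum.reindex)
  also have "\<dots> = (\<Sum>v\<in>verts G. if v \<in> verts y
      then c (vertex_generator G v) * step_sign G s {v} {u, w} else 0)"
    by (intro sum.cong) (auto simp: inc)
  also have "\<dots> = (\<Sum>v\<in>verts y. c (vertex_generator G v) * step_sign G s {v} {u, w})"
    using y_sub assms(2,3) by (subst sum.inter_restrict[symmetric]) (auto intro!: sum.cong)
  finally show ?thesis .
qed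

text \<open>
  The differential is a function on all conceivable generators; this disposes of those that are not
  components of a two-vertex colouring.
\<close>

lemma bold_differential_off_pairs:
  fixes c :: "('a, 'b) bold_generator \<Rightarrow> 'k::field"
  assumes "Digraph.graph G"
    and "\<And>u w. u \<in> verts G \<Longrightarrow> w \<in> verts G \<Longrightarrow> u \<noteq> w \<Longrightarrow> y \<in> components (G \<restriction> {u, w}) \<Longrightarrow>
      \<epsilon> \<noteq> colouring G {u, w}"
  shows "bold_differential G s 1 c (\<epsilon>, y) = 0"
proof -
  have "bold_incidence G s (vertex_generator G v) (\<epsilon>, y) = (0 :: 'k)" if "v \<in> verts G" for v
  proof -
    have "y \<notin> components (coloured_subgraph G \<epsilon>)" if "w \<in> verts G - {v}" "\<epsilon> = colouring G {w, v}" for w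
      using that assms(2)[of w v] \<open>v \<in> verts G\<close> by (auto simp: coloured_subgraph_colouring)
    then show ?thesis
      unfolding bold_incidence_vertex[OF that] by (intro if_not_P) metis
  qed
  then show ?thesis
    unfolding bold_differential_def bold_generators_1[OF assms(1)]
    by (intro sum.neutral ballI) (elim imageE, simp)
qed

lemma components_edge:
  assumes "Digraph.graph G" and "u \<rightarrow>\<^bsub>G\<^esub> w"
  shows "components (G \<restriction> {u, w}) = {G \<restriction> {u, w}}"
proof -
  interpret Digraph.graph G by fact
  have "u \<in> verts G" "w \<in> verts G"
    using assms(2) by (auto simp: arcs_ends_conv)
  then show ?thesis
    using assms(2) graph_symmetric wf_digraph by (intro components_clique) auto
qed

text \<open>
  Both vertices contribute to the same component, and by the sign condition their contributions
  become opposite after each \<open>c\<close> is rescaled by the sign of the step \<open>{} \<rightarrow> {v}\<close>. The value is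
  \<open>\<plusminus>(y u - y w)\<close>; only its vanishing matters, so the sign is left out of the statement.
\<close>

lemma bold_differential_edge:
  fixes c :: "('a, 'b) bold_generator \<Rightarrow> 'k::field"
  assumes "Digraph.graph G" and s: "sign_assignment G s" and "u \<rightarrow>\<^bsub>G\<^esub> w"
  defines "y \<equiv> \<lambda>v. step_sign G s {} {v} * c (vertex_generator G v)"
  shows "bold_differential G s 1 c (colouring G {u, w}, G \<restriction> {u, w}) = 0 \<longleftrightarrow> y u = y w"
proof -
  interpret Digraph.graph G by fact
  have uw: "u \<in> verts G" "w \<in> verts G" "u \<noteq> w"
    using assms(3) no_loops by (auto simp: arcs_ends_conv)
  let ?a = "step_sign G s {} {u} :: 'k" and ?b = "step_sign G s {} {w} :: 'k"
  let ?p = "step_sign G s {u} {u, w} :: 'k" and ?q = "step_sign G s {w} {u, w} :: 'k"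
  have d: "bold_differential G s 1 c (colouring G {u, w}, G \<restriction> {u, w}) =
      c (vertex_generator G u) * ?p + c (vertex_generator G w) * ?q"
    using bold_differential_pair[OF assms(1) uw, of "G \<restriction> {u, w}"] components_edge[OF assms(1,3)] uw
    by simp
  have sq: "?a * ?p = - (?b * ?q)"
    using step_sign_square[OF s uw] .
  have signs: "?a * ?a = 1" "?b * ?b = 1"
    by (simp_all add: step_sign_def)
  \<comment> \<open>Each sign squares to 1: cancelling \<open>?a\<close> with itself, and \<open>?b\<close> after rewriting by \<open>sq\<close>,
    shows that the differential is \<open>y u - y w\<close> up to the nonzero factor \<open>?a * ?p\<close>.\<close>
  have "?a * ?p * (y u - y w) = (?a * ?a) * (c (vertex_generator G u) * ?p)
      - (?a * ?p) * (?b * c (vertex_generator G w))"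
    by (simp add: y_def algebra_simps)
  also have "\<dots> = bold_differential G s 1 c (colouring G {u, w}, G \<restriction> {u, w})"
    using signs(2) unfolding sq d signs(1) by (simp add: algebra_simps)
  finally show "bold_differential G s 1 c (colouring G {u, w}, G \<restriction> {u, w}) = 0 \<longleftrightarrow> y u = y w"
    using step_sign_nonzero by (metis mult_eq_0_iff right_minus_eq)
qed

text \<open>
  Without an arc between them, \<open>u\<close> and \<open>w\<close> form separate components, and the component of \<open>u\<close>
  does not contain \<open>w\<close>, so the generator of \<open>w\<close> contributes nothing to it.
\<close>

lemma bold_differential_nonedge:
  fixes c :: "('a, 'b) bold_generator \<Rightarrow> 'k::field"
  assumes "Digraph.graph G" and "u \<in> verts G" and "w \<in> verts G" and "u \<noteq> w" and "\<not> u \<rightarrow>\<^bsub>G\<^esub> w"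
  shows "bold_differential G s 1 c (colouring G {u, w}, G \<restriction> {u}) =
    c (vertex_generator G u) * step_sign G s {u} {u, w}"
proof -
  interpret Digraph.graph G by fact
  let ?H = "G \<restriction> {u, w}"
  have "arcs ?H = {}"
  proof (rule equals0I)
    fix e assume "e \<in> arcs ?H"
    then have "e \<in> arcs G" "tail G e \<in> {u, w}" "head G e \<in> {u, w}" "tail G e \<noteq> head G e"
      using no_loops by auto
    then have "u \<rightarrow>\<^bsub>G\<^esub> w \<or> w \<rightarrow>\<^bsub>G\<^esub> u"
      by (auto dest!: in_arcs_imp_in_arcs_ends)
    then show False
      using assms(5) graph_symmetric by blast
  qed
  then have "?H \<restriction> {u} \<in> components ?H"
    by (intro singleton_component_arcless) auto
  moreover have "?H \<restriction> {u} = G \<restriction> {u}"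
    by (auto simp: induce_subgraph_def)
  ultimately have "G \<restriction> {u} \<in> components ?H"
    by simp
  from bold_differential_pair[OF assms(1-4) this] show ?thesis
    by simp
qed

section \<open>Degree-one cycles\<close>

lemma complete_digraph_iff:
  assumes "Digraph.graph G"
  shows "complete_digraph (card (verts G)) G \<longleftrightarrow>
    (\<forall>u\<in>verts G. \<forall>w\<in>verts G. u \<noteq> w \<longrightarrow> u \<rightarrow>\<^bsub>G\<^esub> w)"
proof -
  interpret Digraph.graph G by fact
  have "u \<in> verts G \<and> w \<in> verts G \<and> u \<noteq> w" if "u \<rightarrow>\<^bsub>G\<^esub> w" for u w
    using that no_loops by (auto simp: arcs_ends_conv)
  then show ?thesis
    using assms by (auto simp: complete_digraph_def)
qed

lemma bold_cycles_1_complete: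
  fixes G :: "('a, 'b) pre_digraph"
  assumes "Digraph.graph G" and "verts G \<noteq> {}" and s: "sign_assignment G s"
    and complete: "complete_digraph (card (verts G)) G"
  shows "\<exists>c\<in>bold_cycles G s 1. c \<noteq> (\<lambda>_. 0 :: 'k::field)"
proof -
  \<comment> \<open>The signs are their own inverses, so this choice makes every rescaled coefficient equal to 1.\<close>
  define c :: "('a, 'b) bold_generator \<Rightarrow> 'k" where
    "c = (\<lambda>b. if b \<in> bold_generators G 1
      then step_sign G s {} {the_inv_into (verts G) (vertex_generator G) b} else 0)"
  have c: "c (vertex_generator G v) = step_sign G s {} {v}" if "v \<in> verts G" for v
    using that by (simp add: c_def bold_generators_1[OF assms(1), simplified]
        the_inv_into_f_f[OF inj_on_vertex_generator])
  have "bold_differential G s 1 c (\<epsilon>, x) = 0" for \<epsilon> x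
  proof (rule ccontr)
    assume nz: "bold_differential G s 1 c (\<epsilon>, x) \<noteq> 0"
    then obtain u w where uw: "u \<in> verts G" "w \<in> verts G" "u \<noteq> w"
      and x: "x \<in> components (G \<restriction> {u, w})" and \<epsilon>: "\<epsilon> = colouring G {u, w}"
      using bold_differential_off_pairs[OF assms(1)] by metis
    have e: "u \<rightarrow>\<^bsub>G\<^esub> w"
      using complete uw complete_digraph_iff[OF assms(1)] by blast
    have "step_sign G s {} {u} * c (vertex_generator G u) =
        step_sign G s {} {w} * c (vertex_generator G w)"
      using uw by (simp add: c step_sign_def)
    with bold_differential_edge[OF assms(1) s e, of c] components_edge[OF assms(1) e] x nz \<epsilon>
    show False
      by simp
  qed
  then have "c \<in> bold_cycles G s 1"
    unfolding bold_cycles_iff by (simp add: c_def split_paired_all)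
  moreover have "c \<noteq> (\<lambda>_. 0)"
    using assms(2) c step_sign_nonzero by (metis ex_in_conv)
  ultimately show ?thesis
    by blast
qed

text \<open>
  The rescaled coefficients of a cycle agree along each edge, hence along walks, and a connected
  graph has a walk between any two vertices.
\<close>

lemma bold_cycles_1_constant:
  fixes c :: "('a, 'b) bold_generator \<Rightarrow> 'k::field"
  assumes "Digraph.graph G" and conn: "Digraph_Component.connected G" and s: "sign_assignment G s"
    and c: "c \<in> bold_cycles G s 1" and "u \<in> verts G" and "w \<in> verts G"
  shows "step_sign G s {} {u} * c (vertex_generator G u) =
    step_sign G s {} {w} * c (vertex_generator G w)"
proof -
  interpret Digraph.graph G by fact
  have "u \<rightarrow>\<^sup>*\<^bsub>G\<^esub> w"
    using symmetric_connected_imp_strongly_connected[OF sym_arcs conn] assms(5,6) by auto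
  then have "(u, w) \<in> rtrancl_on (verts G) (arcs_ends G)"
    by (simp add: reachable_def)
  then show ?thesis
  proof (induction rule: rtrancl_on.induct)
    case (rtrancl_on_into_rtrancl_on v w x)
    have "bold_differential G s 1 c (colouring G {w, x}, G \<restriction> {w, x}) = 0"
      using c by (simp only: bold_cycles_iff)
    with bold_differential_edge[OF assms(1) s rtrancl_on_into_rtrancl_on(2), of c]
      rtrancl_on_into_rtrancl_on.IH
    show ?case
      by simp
  qed simp
qed

text \<open>
  One non-adjacent pair makes one coefficient zero, and constancy of the rescaled coefficients
  spreads this zero to every vertex.
\<close>

lemma bold_cycles_1_incomplete:
  fixes c :: "('a, 'b) bold_generator \<Rightarrow> 'k::field"
  assumes "Digraph.graph G" and "Digraph_Component.connected G" and "sign_assignment G s"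
    and incomplete: "\<not> complete_digraph (card (verts G)) G"
    and c: "c \<in> bold_cycles G s 1"
  shows "c = (\<lambda>_. 0)"
proof
  fix b
  obtain u w where uw: "u \<in> verts G" "w \<in> verts G" "u \<noteq> w" "\<not> u \<rightarrow>\<^bsub>G\<^esub> w"
    using incomplete complete_digraph_iff[OF assms(1)] by blast
  have "bold_differential G s 1 c (colouring G {u, w}, G \<restriction> {u}) = 0"
    using c by (simp only: bold_cycles_iff)
  then have u0: "c (vertex_generator G u) = 0"
    using bold_differential_nonedge[OF assms(1) uw, of s c] by (simp add: step_sign_nonzero)
  show "c b = 0"
  proof (cases "b \<in> bold_generators G 1")
    case True
    then obtain v where "v \<in> verts G" "b = vertex_generator G v"
      unfolding bold_generators_1[OF assms(1)] by blast
    then show ?thesis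
      using bold_cycles_1_constant[OF assms(1-3) c uw(1), of v] u0
      by (simp add: step_sign_nonzero)
  next
    case False
    then show ?thesis
      using c unfolding bold_cycles_iff by blast
  qed
qed

theorem theorem1p4:
  fixes G :: "('a, 'b) pre_digraph"
    and s :: "('a \<Rightarrow> nat) \<Rightarrow> ('a \<Rightarrow> nat) \<Rightarrow> bit"
    and H1 :: "(('a, 'b) bold_generator \<Rightarrow> 'k::field) set monoid"
  assumes "Digraph.graph G"
    and "verts G \<noteq> {}"
    and "Digraph_Component.connected G"
    and "sign_assignment G s"
    and "H1 = bold_homology G s 1"
  shows "carrier H1 \<noteq> {\<one>\<^bsub>H1\<^esub>} \<longleftrightarrow> complete_digraph (card (verts G)) G"
proof -
  interpret Digraph.graph G by fact
  show ?thesis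
    using bold_homology_1_nontrivial_iff[OF finite_verts assms(5)]
      bold_cycles_1_complete[OF assms(1,2,4)] bold_cycles_1_incomplete[OF assms(1,3,4)]
    by blast
qed

end
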